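(* Let $\varepsilon(x,\xi)\ge 0$, $\rho(x,\xi)$, $f(x,\xi)$ be elements of $C^1(\mathbb{S}D)$, put $\alpha=\varepsilon+\mathrm{i}\rho$, and let $k\ge 1$ be an integer. Let $u_k$ and $u_{k-1}$ be the attenuated ray transforms of $f$ of orders $k$ and $k-1$. Then $$\big((\mathcal{H}+\alpha)u_k\big)(x,\xi)=k\,u_{k-1}(x,\xi),\qquad (x,\xi)\in\mathbb{S}D .$$
   Context: $D\subset\mathbb{R}^3$ is a bounded convex domain with smooth boundary, $\mathbb{S}^2$ is the unit sphere of $\mathbb{R}^3$, and $\mathbb{S}D=\{(x,\xi): x\in D,\ \xi\in\mathbb{S}^2\}$. The functions $\varepsilon,\rho$ are real-valued. The functions $\varepsilon,\rho,f$ are bounded and finite with respect to $x$, i.e. they vanish for $x$ outside some compact subset of $D$; they are extended by zero to all $x\in\mathbb{R}^3$. The attenuated ray transform (ART) of order $k\ge 0$ of $f$ is $$u_k(x,\xi)=\int_0^\infty s^k\exp\Big(-\int_0^s\alpha(x-\sigma\xi,\xi)\,d\sigma\Big) f(x-s\xi,\xi)\,ds .$$ The operator $\mathcal{H}$ is $(\mathcal{H}\psi)(x,\xi)=\frac{d}{d\tau}\psi(x+\tau\xi,\xi)\big|_{\tau=0}=\sum_{j=1}^3\xi^j\frac{\partial\psi}{\partial x^j}(x,\xi)$, and $\alpha$ acts by multiplication. *)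

theory Defs
  imports "HOL-Analysis.Analysis"
begin

text \<open>\<open>C\<^sup>n\<close> on an open set \<open>U\<close>, by iterated partial derivatives.\<close>

primrec Cn_on :: "nat \<Rightarrow> 'a::euclidean_space set \<Rightarrow> ('a \<Rightarrow> 'b::real_normed_vector) \<Rightarrow> bool" where
  "Cn_on 0 U g \<longleftrightarrow> continuous_on U g"
| "Cn_on (Suc n) U g \<longleftrightarrow> (\<forall>x\<in>U. g differentiable (at x)) \<and>
     (\<forall>b\<in>Basis. Cn_on n U (\<lambda>x. frechet_derivative g (at x) b))"

text \<open>
  \<open>C\<^sup>1\<close> on a subset \<open>S\<close> that need not be open: locally on \<open>S\<close> the function is the restriction of
  a \<open>C\<^sup>1\<close> function of the ambient space. For an embedded submanifold, such as \<open>D \<times> sphere 0 1\<close>,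
  this is the \<open>C\<^sup>1\<close> property in the sense of manifolds.
\<close>

definition C1_on_set :: "'a::euclidean_space set \<Rightarrow> ('a \<Rightarrow> 'b::real_normed_vector) \<Rightarrow> bool" where
  "C1_on_set S g \<longleftrightarrow> (\<forall>p\<in>S. \<exists>U h. open U \<and> p \<in> U \<and> Cn_on 1 U h \<and> (\<forall>q\<in>S \<inter> U. h q = g q))"

text \<open>Near each boundary point the set is a strict sublevel set of a \<open>C\<^sup>\<infinity>\<close> function whose
  differential does not vanish there.\<close>

definition smooth_boundary :: "'a::euclidean_space set \<Rightarrow> bool" where
  "smooth_boundary D \<longleftrightarrow> (\<forall>p\<in>frontier D. \<exists>U (\<phi> :: 'a \<Rightarrow> real). open U \<and> p \<in> U \<and>
     (\<forall>n. Cn_on n U \<phi>) \<and> (\<exists>v. frechet_derivative \<phi> (at p) v \<noteq> 0) \<and>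
     D \<inter> U = {x \<in> U. \<phi> x < 0})"

definition sphere_bundle :: "(real^3) set \<Rightarrow> ((real^3) \<times> (real^3)) set" where
  "sphere_bundle D = D \<times> sphere 0 1"

text \<open>Functions are total; this condition, which ranges over all \<open>x\<close> and not only over \<open>x \<in> D\<close>,
  also encodes the extension by zero from \<open>D\<close> to the whole space.\<close>

definition finite_in_x :: "(real^3) set \<Rightarrow> ((real^3) \<times> (real^3) \<Rightarrow> 'b::zero) \<Rightarrow> bool" where
  "finite_in_x D g \<longleftrightarrow> (\<exists>K. compact K \<and> K \<subseteq> D \<and> (\<forall>x \<xi>. x \<notin> K \<longrightarrow> \<xi> \<in> sphere 0 1 \<longrightarrow> g (x, \<xi>) = 0))"

definition ART :: "((real^3) \<times> (real^3) \<Rightarrow> complex) \<Rightarrow> ((real^3) \<times> (real^3) \<Rightarrow> complex) \<Rightarrow> nat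
    \<Rightarrow> (real^3) \<times> (real^3) \<Rightarrow> complex" where
  "ART \<alpha> f k = (\<lambda>(x, \<xi>). integral {0..} (\<lambda>s.
     of_real (s ^ k) * exp (- integral {0..s} (\<lambda>\<sigma>. \<alpha> (x - \<sigma> *\<^sub>R \<xi>, \<xi>))) * f (x - s *\<^sub>R \<xi>, \<xi>)))"

text \<open>\<open>vector_derivative\<close> is an arbitrary value where no derivative exists, so a claim about
  \<open>H_op \<psi>\<close> has to be paired with differentiability of \<open>\<psi>\<close> in \<open>x\<close>; under that condition it is also
  the sum of weighted partial derivatives, by \<open>H_op_eq_sum_partials\<close> below.\<close>

definition H_op :: "((real^3) \<times> (real^3) \<Rightarrow> complex) \<Rightarrow> (real^3) \<times> (real^3) \<Rightarrow> complex" where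
  "H_op \<psi> = (\<lambda>(x, \<xi>). vector_derivative (\<lambda>\<tau>. \<psi> (x + \<tau> *\<^sub>R \<xi>, \<xi>)) (at 0))"

lemma H_op_eq_sum_partials:
  assumes "(\<lambda>y. \<psi> (y, \<xi>)) differentiable (at x)"
  shows "H_op \<psi> (x, \<xi>) =
    (\<Sum>j\<in>UNIV. of_real (\<xi> $ j) * vector_derivative (\<lambda>t. \<psi> (x + t *\<^sub>R axis j 1, \<xi>)) (at 0))"
proof -
  obtain L where L: "((\<lambda>y. \<psi> (y, \<xi>)) has_derivative L) (at x)"
    using assms by (auto simp: differentiable_def)
  have lin: "linear L"
    using L by (rule has_derivative_linear)
  have dir: "vector_derivative (\<lambda>t. \<psi> (x + t *\<^sub>R v, \<xi>)) (at 0) = L v" for v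
  proof -
    have 1: "((\<lambda>t. x + t *\<^sub>R v) has_derivative (\<lambda>t. t *\<^sub>R v)) (at (0::real))"
      by (auto intro!: derivative_eq_intros)
    have "((\<lambda>t. \<psi> (x + t *\<^sub>R v, \<xi>)) has_derivative (\<lambda>t. L (t *\<^sub>R v))) (at (0::real))"
      using has_derivative_compose[OF 1, of "\<lambda>y. \<psi> (y, \<xi>)" L] L by simp
    then have "((\<lambda>t. \<psi> (x + t *\<^sub>R v, \<xi>)) has_vector_derivative L v) (at 0)"
      by (simp add: has_vector_derivative_def linear_scale[OF lin])
    then show ?thesis
      by (rule vector_derivative_at)
  qed
  have "L \<xi> = L (\<Sum>j\<in>UNIV. \<xi> $ j *\<^sub>R axis j 1)"
    using basis_expansion[of \<xi>] by (simp add: scalar_mult_eq_scaleR)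
  also have "\<dots> = (\<Sum>j\<in>UNIV. \<xi> $ j *\<^sub>R L (axis j 1))"
    by (simp add: linear_sum[OF lin] linear_scale[OF lin])
  also have "\<dots> = (\<Sum>j\<in>UNIV. of_real (\<xi> $ j) * L (axis j 1))"
    by (simp only: scaleR_conv_of_real)
  finally show ?thesis
    by (simp add: H_op_def dir)
qed

end

theory Submission imports Defs begin

text \<open>
  Fix the direction \<open>\<xi>\<close> and write \<open>a\<close>, \<open>g\<close> for \<open>\<alpha>\<close>, \<open>f\<close> as functions of \<open>x\<close> alone. Both vanish
  outside a compact subset of the open set \<open>D\<close>, so extension by zero keeps them \<open>C\<^sup>1\<close> on the whole
  space (\<open>sphere_bundle_slice_C1\<close>).
  The integrand of the transform of order \<open>k\<close> is
  \<open>W\<^sub>k(y, s) = s\<^sup>k exp(- \<integral>\<^sub>0\<^sup>s a(y - \<sigma>\<xi>) d\<sigma>) g(y - s\<xi>)\<close>. For \<open>y\<close> near a given point it vanishes for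
  all \<open>s\<close> beyond a common bound \<open>R\<close>, because \<open>g\<close> has bounded support. The half line can thus be
  replaced by \<open>[0, R]\<close>, where differentiation under the integral sign is allowed.

  The identity then comes from a pointwise relation between the derivatives of \<open>W\<^sub>k\<close> along the ray
  parameter \<open>s\<close> and along \<open>\<xi>\<close>,
  \<open>\<partial>W\<^sub>k/\<partial>s = k W\<^sub>k\<^sub>-\<^sub>1 - a(y) W\<^sub>k - \<xi> \<bullet> \<nabla>W\<^sub>k\<close>,
  which is \<open>weighted_has_vector_derivative\<close>. It rests on two observations. Moving \<open>y\<close> by \<open>\<tau>\<xi>\<close> and
  moving \<open>s\<close> by \<open>\<tau>\<close> have opposite effects on \<open>g(y - s\<xi>)\<close>. In the exponent,
  \<open>\<xi> \<bullet> \<nabla>\<close> turns \<open>\<integral>\<^sub>0\<^sup>s a(y - \<sigma>\<xi>) d\<sigma>\<close> into \<open>a(y) - a(y - s\<xi>)\<close> (\<open>depth'_along_ray\<close>), whereas \<open>\<partial>/\<partial>s\<close> turns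
  it into \<open>a(y - s\<xi>)\<close>; the sum of the two is \<open>a(y)\<close>, a factor that does not depend on \<open>s\<close>.
  Integrating over \<open>[0, R]\<close>, the left side contributes \<open>W\<^sub>k(y, R) - W\<^sub>k(y, 0)\<close>. This is zero: at \<open>R\<close>
  because \<open>g\<close> vanishes there, at \<open>0\<close> because of the factor \<open>s\<^sup>k\<close> with \<open>k \<ge> 1\<close>
  (\<open>weighted_transport\<close>).
\<close>

section \<open>Integrals along rays of varying length\<close>

lemma integral_unit_rescale:
  fixes h :: "real \<Rightarrow> 'b::banach"
  assumes "continuous_on {0..s} h" and "0 \<le> s"
  shows "integral {0..s} h = s *\<^sub>R integral {0..1} (\<lambda>t. h (s * t))"
proof (cases "s = 0")
  case False
  with assms(2) have s: "s > 0" by simp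
  have "(h has_integral integral {0..s} h) {0..s}"
    using assms(1) by (intro integrable_integral integrable_continuous_real)
  from has_integral_stretch_real[OF this False]
  have "((\<lambda>t. h (s * t)) has_integral (1 / \<bar>s\<bar>) *\<^sub>R integral {0..s} h) ((\<lambda>x. x / s) ` {0..s})" .
  moreover have "(\<lambda>x. x / s) ` {0..s} = {0..1}"
  proof -
    have "t \<in> (\<lambda>x. x / s) ` {0..s}" if "t \<in> {0..1}" for t
      using that s by (intro image_eqI[of _ _ "t * s"]) (auto simp: mult_left_le_one_le)
    then show ?thesis using s by auto
  qed
  ultimately show ?thesis
    using s by (simp add: integral_unique)
qed simp

text \<open>
  Rescaling to a fixed interval of integration moves the variable endpoint into the integrand, so
  that the length of the ray becomes an ordinary parameter.
\<close>

lemma continuous_on_ray_integral: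
  fixes q :: "'a::euclidean_space \<Rightarrow> 'b::banach"
  assumes q: "continuous_on UNIV q"
  shows "continuous_on (UNIV \<times> {0..}) (\<lambda>p. integral {0..snd p} (\<lambda>\<sigma>. q (fst p - \<sigma> *\<^sub>R v)))"
proof -
  note [continuous_intros] = continuous_on_compose2[OF q _ subset_UNIV]
  have "continuous_on (UNIV \<times> {0..})
      (\<lambda>p. integral (cbox 0 1) (\<lambda>t::real. q (fst p - (snd p * t) *\<^sub>R v)))"
    by (rule integral_continuous_on_param) (auto simp: split_beta intro!: continuous_intros)
  then have "continuous_on (UNIV \<times> {0..})
      (\<lambda>p. snd p *\<^sub>R integral {0..1} (\<lambda>t. q (fst p - (snd p * t) *\<^sub>R v)))"
    by (auto intro!: continuous_intros)
  then show ?thesis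
    by (rule continuous_on_eq) (auto intro!: integral_unit_rescale[symmetric] continuous_intros)
qed

section \<open>The transport equation for a fixed direction\<close>

text \<open>
  Derivatives are carried as bounded linear functions because differentiation under the integral
  sign integrates the derivative itself, as an element of a Banach space.
\<close>

locale attenuated_ray =
  fixes a g :: "'a::euclidean_space \<Rightarrow> complex"
    and a' g' :: "'a \<Rightarrow> 'a \<Rightarrow>\<^sub>L complex"
    and v :: 'a
  assumes a_deriv: "(a has_derivative blinfun_apply (a' y)) (at y)"
    and a'_cont: "continuous_on UNIV a'"
    and g_deriv: "(g has_derivative blinfun_apply (g' y)) (at y)"
    and g'_cont: "continuous_on UNIV g'"
begin

definition depth :: "'a \<Rightarrow> real \<Rightarrow> complex" where
  "depth y s = integral {0..s} (\<lambda>\<sigma>. a (y - \<sigma> *\<^sub>R v))"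

definition depth' :: "'a \<Rightarrow> real \<Rightarrow> 'a \<Rightarrow>\<^sub>L complex" where
  "depth' y s = integral {0..s} (\<lambda>\<sigma>. a' (y - \<sigma> *\<^sub>R v))"

definition weighted :: "nat \<Rightarrow> 'a \<Rightarrow> real \<Rightarrow> complex" where
  "weighted k y s = of_real (s ^ k) * exp (- depth y s) * g (y - s *\<^sub>R v)"

definition weighted' :: "nat \<Rightarrow> 'a \<Rightarrow> real \<Rightarrow> 'a \<Rightarrow>\<^sub>L complex" where
  "weighted' k y s = blinfun_mult_right (of_real (s ^ k) * exp (- depth y s)) o\<^sub>L
     (g' (y - s *\<^sub>R v) - (blinfun_mult_right (g (y - s *\<^sub>R v)) o\<^sub>L depth' y s))"

lemma a_cont: "continuous_on UNIV a" and g_cont: "continuous_on UNIV g"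
  using a_deriv g_deriv
  by (auto intro!: has_derivative_continuous_on simp: has_derivative_at_withinI)

lemmas data_continuous [continuous_intros] =
  continuous_on_compose2[OF a_cont _ subset_UNIV]
  continuous_on_compose2[OF g_cont _ subset_UNIV]
  continuous_on_compose2[OF a'_cont _ subset_UNIV]
  continuous_on_compose2[OF g'_cont _ subset_UNIV]

lemma depth_continuous:
  "continuous_on (UNIV \<times> {0..}) (\<lambda>p. depth (fst p) (snd p))"
  "continuous_on (UNIV \<times> {0..}) (\<lambda>p. depth' (fst p) (snd p))"
  unfolding depth_def depth'_def
  by (intro continuous_on_ray_integral a_cont a'_cont)+

lemma depth_continuous_compose [continuous_intros]:
  assumes "continuous_on S p" "continuous_on S q" "\<And>z. z \<in> S \<Longrightarrow> 0 \<le> q z"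
  shows "continuous_on S (\<lambda>z. depth (p z) (q z))" "continuous_on S (\<lambda>z. depth' (p z) (q z))"
  using continuous_on_compose2[OF depth_continuous(1), of S "\<lambda>z. (p z, q z)"]
    continuous_on_compose2[OF depth_continuous(2), of S "\<lambda>z. (p z, q z)"] assms
  by (auto intro!: continuous_intros)

lemma ray_compose_has_derivative:
  assumes "\<And>z. (q has_derivative blinfun_apply (q' z)) (at z)"
  shows "((\<lambda>y. q (y - s *\<^sub>R v)) has_derivative blinfun_apply (q' (y - s *\<^sub>R v))) (at y within S)"
proof -
  have "((\<lambda>y. y - s *\<^sub>R v) has_derivative (\<lambda>h. h)) (at y within S)"
    by (auto intro!: derivative_eq_intros)
  from has_derivative_compose[OF this assms] show ?thesis .
qed

lemma ray_compose_has_vector_derivative: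
  assumes "\<And>z. (q has_derivative blinfun_apply (q' z)) (at z)"
  shows "((\<lambda>s. q (y - s *\<^sub>R v)) has_vector_derivative - q' (y - s *\<^sub>R v) v) (at s within S)"
proof -
  have "((\<lambda>s. y - s *\<^sub>R v) has_derivative (\<lambda>h. - h *\<^sub>R v)) (at s within S)"
    by (auto intro!: derivative_eq_intros)
  from has_derivative_compose[OF this assms] show ?thesis
    by (simp add: has_vector_derivative_def blinfun.minus_right blinfun.scaleR_right)
qed

lemma depth_has_derivative:
  "((\<lambda>y. depth y s) has_derivative blinfun_apply (depth' y s)) (at y)"
  unfolding depth_def depth'_def cbox_interval[symmetric]
proof (rule leibniz_rule[where U = UNIV])
  show "((\<lambda>y. a (y - \<sigma> *\<^sub>R v)) has_derivative blinfun_apply (a' (y - \<sigma> *\<^sub>R v))) (at y within UNIV)"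
    for y \<sigma>
    by (intro ray_compose_has_derivative a_deriv)
  show "(\<lambda>\<sigma>. a (y - \<sigma> *\<^sub>R v)) integrable_on cbox 0 s" for y
    by (intro integrable_continuous continuous_intros)
  show "continuous_on (UNIV \<times> cbox 0 s) (\<lambda>(y, \<sigma>). a' (y - \<sigma> *\<^sub>R v))"
    unfolding split_beta by (intro continuous_intros)
qed simp_all

text \<open>
  Up to sign, the derivative of \<open>a\<close> in the direction of the ray is the derivative of
  \<open>a (y - \<sigma> *\<^sub>R v)\<close> in \<open>\<sigma>\<close>, so that its integral telescopes.
\<close>

lemma depth'_along_ray:
  assumes "0 \<le> s"
  shows "depth' y s v = a y - a (y - s *\<^sub>R v)"
proof -
  have "((\<lambda>\<sigma>. - a' (y - \<sigma> *\<^sub>R v) v) has_integral a (y - s *\<^sub>R v) - a (y - 0 *\<^sub>R v)) {0..s}"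
    using assms
    by (intro fundamental_theorem_of_calculus ray_compose_has_vector_derivative a_deriv)
  from integral_unique[OF has_integral_neg[OF this]]
  have "integral {0..s} (\<lambda>\<sigma>. a' (y - \<sigma> *\<^sub>R v) v) = a y - a (y - s *\<^sub>R v)"
    by simp
  moreover have "(\<lambda>\<sigma>. a' (y - \<sigma> *\<^sub>R v)) integrable_on {0..s}"
    by (intro integrable_continuous_real continuous_intros)
  ultimately show ?thesis
    by (simp add: depth'_def blinfun_apply_integral)
qed

lemma weighted_has_derivative:
  "((\<lambda>y. weighted k y s) has_derivative blinfun_apply (weighted' k y s)) (at y within S)"
proof -
  have "((\<lambda>y. exp (- depth y s)) has_derivative (\<lambda>h. exp (- depth y s) * - depth' y s h)) (at y within S)"
    by (rule has_derivative_compose[OF has_derivative_minus DERIV_exp[unfolded has_field_derivative_def]])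
      (rule has_derivative_at_withinI[OF depth_has_derivative])
  from has_derivative_mult[OF has_derivative_mult_right[OF this]
      ray_compose_has_derivative[of g, OF g_deriv], of "of_real (s ^ k)" s]
  show ?thesis
    unfolding weighted_def weighted'_def
    by (rule has_derivative_eq_rhs) (simp add: fun_eq_iff blinfun.diff_left algebra_simps)
qed

lemma weighted_continuous:
  "continuous_on ({0..R}) (weighted k y)"
  "continuous_on (UNIV \<times> {0..R}) (\<lambda>(y, s). weighted' k y s)"
  unfolding weighted_def weighted'_def split_beta
  by (auto intro!: continuous_intros)

lemma weighted_integral_has_derivative:
  "((\<lambda>y. integral {0..R} (weighted k y)) has_derivative
      blinfun_apply (integral {0..R} (weighted' k y))) (at y)"
  unfolding cbox_interval[symmetric]
proof (rule leibniz_rule[where U = UNIV])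
  show "((\<lambda>y. weighted k y s) has_derivative blinfun_apply (weighted' k y s)) (at y within UNIV)"
    for y s
    by (rule weighted_has_derivative)
  show "weighted k y integrable_on cbox 0 R" for y
    unfolding cbox_interval by (intro integrable_continuous_real weighted_continuous)
  show "continuous_on (UNIV \<times> cbox 0 R) (\<lambda>(y, s). weighted' k y s)"
    unfolding cbox_interval by (rule weighted_continuous)
qed simp_all

text \<open>
  The pointwise form of the transport equation. The terms with \<open>a (y - s *\<^sub>R v)\<close> and with \<open>g'\<close> that
  the product rule in \<open>s\<close> produces are exactly those in \<open>weighted' k y s v\<close>, with opposite sign; the
  term \<open>a y\<close> is what \<open>depth'\<close> leaves over.
\<close>

lemma weighted_has_vector_derivative:
  assumes "s \<in> {0..R}"
  shows "(weighted k y has_vector_derivative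
     of_nat k * weighted (k - 1) y s - a y * weighted k y s - weighted' k y s v)
     (at s within {0..R})"
proof -
  have "((depth y) has_vector_derivative a (y - s *\<^sub>R v)) (at s within {0..R})"
    unfolding depth_def using assms
    by (intro integral_has_vector_derivative continuous_intros)
  from field_vector_diff_chain_within[OF has_vector_derivative_minus[OF this]
      has_field_derivative_at_within[OF DERIV_exp]]
  have attenuation: "((\<lambda>s. exp (- depth y s)) has_vector_derivative
      - a (y - s *\<^sub>R v) * exp (- depth y s)) (at s within {0..R})"
    by (simp add: o_def)
  have power: "((\<lambda>s. of_real (s ^ k)) has_vector_derivative
      of_real (of_nat k * s ^ (k - 1))) (at s within {0..R})"
    by (intro has_vector_derivative_of_real) (auto intro!: derivative_eq_intros)
  from has_vector_derivative_mult[OF has_vector_derivative_mult[OF power attenuation]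
      ray_compose_has_vector_derivative[of g, OF g_deriv]]
  have "(weighted k y has_vector_derivative
      of_real (s ^ k) * exp (- depth y s) * - g' (y - s *\<^sub>R v) v +
      (of_real (s ^ k) * (- a (y - s *\<^sub>R v) * exp (- depth y s)) +
        of_real (of_nat k * s ^ (k - 1)) * exp (- depth y s)) * g (y - s *\<^sub>R v))
      (at s within {0..R})"
    unfolding weighted_def .
  then show ?thesis
    by (rule has_vector_derivative_eq_rhs)
      (use assms in \<open>simp add: weighted_def weighted'_def depth'_along_ray blinfun.diff_left
        algebra_simps\<close>)
qed

text \<open>
  The integrated form. Both boundary terms have to vanish: the one at \<open>R\<close> through \<open>g\<close>, the one at
  \<open>0\<close> through \<open>s ^ k\<close>; for \<open>k = 0\<close> the latter would leave the source term \<open>g y\<close>.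
\<close>

lemma weighted_transport:
  assumes "1 \<le> k" and "0 \<le> R" and "g (y - R *\<^sub>R v) = 0"
  shows "integral {0..R} (weighted' k y) v + a y * integral {0..R} (weighted k y)
    = of_nat k * integral {0..R} (weighted (k - 1) y)"
proof -
  have W: "weighted j y integrable_on {0..R}" for j
    by (intro integrable_continuous_real weighted_continuous)
  have "continuous_on {0..R} (weighted' k y)"
    unfolding weighted'_def by (auto intro!: continuous_intros)
  then have W': "weighted' k y integrable_on {0..R}"
    by (rule integrable_continuous_real)
  have W'v: "(\<lambda>s. weighted' k y s v) integrable_on {0..R}"
    using integrable_linear[OF W' blinfun.bounded_linear_left[of v]] by (simp add: o_def)
  have "((\<lambda>s. of_nat k * weighted (k - 1) y s - a y * weighted k y s - weighted' k y s v)
      has_integral weighted k y R - weighted k y 0) {0..R}"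
    using assms(2) by (intro fundamental_theorem_of_calculus weighted_has_vector_derivative)
  moreover have "weighted k y R - weighted k y 0 = 0"
    using assms by (simp add: weighted_def)
  moreover have "((\<lambda>s. of_nat k * weighted (k - 1) y s - a y * weighted k y s - weighted' k y s v)
      has_integral of_nat k * integral {0..R} (weighted (k - 1) y)
        - a y * integral {0..R} (weighted k y) - integral {0..R} (weighted' k y) v) {0..R}"
    using W W'v
    by (auto intro!: has_integral_diff has_integral_mult_right
        simp: blinfun_apply_integral[OF W'] integrable_integral)
  ultimately show ?thesis
    by (auto dest: has_integral_unique simp: algebra_simps)
qed

lemma half_line_truncation:
  assumes "\<And>s. R < s \<Longrightarrow> g (y - s *\<^sub>R v) = 0"
  shows "integral {0..} (weighted k y) = integral {0..R} (weighted k y)"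
proof -
  have "integral {0..} (\<lambda>s. if s \<in> {0..R} then weighted k y s else 0) =
      integral ({0..R} \<inter> {0..}) (weighted k y)"
    by (rule integral_restrict_Int)
  moreover have "integral {0..} (\<lambda>s. if s \<in> {0..R} then weighted k y s else 0) =
      integral {0..} (weighted k y)"
    using assms by (intro integral_cong) (auto simp: weighted_def)
  moreover have "{0..R} \<inter> {0..} = {0..R}" by auto
  ultimately show ?thesis by simp
qed

lemma transport_equation:
  assumes "1 \<le> k" and "v \<noteq> 0" and "bounded K" and "\<And>y. y \<notin> K \<Longrightarrow> g y = 0"
  obtains L where "((\<lambda>y. integral {0..} (weighted k y)) has_derivative L) (at x)"
    and "L v + a x * integral {0..} (weighted k x) = of_nat k * integral {0..} (weighted (k - 1) x)"
proof -
  obtain M where M: "\<And>y. y \<in> K \<Longrightarrow> norm y \<le> M" and "M > 0"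
    using assms(3) by (auto simp: bounded_pos)
  \<comment> \<open>For \<open>y\<close> in the unit ball about \<open>x\<close> the point \<open>y - s *\<^sub>R v\<close> has norm greater than
    \<open>s * norm v - norm x - 1\<close>, which is at least \<open>M\<close> from \<open>s = R\<close> on. One \<open>R\<close> for a whole
    neighbourhood of \<open>x\<close> is needed to differentiate at \<open>x\<close>.\<close>
  define R where "R = (M + norm x + 1) / norm v"
  have "R \<ge> 0" using \<open>M > 0\<close> by (simp add: R_def)
  have vanish: "g (y - s *\<^sub>R v) = 0" if "y \<in> ball x 1" "R \<le> s" for y s
  proof (rule assms(4), rule notI)
    assume "y - s *\<^sub>R v \<in> K"
    then have "norm (y - s *\<^sub>R v) \<le> M" by (rule M)
    moreover have "norm (s *\<^sub>R v) \<le> norm y + norm (y - s *\<^sub>R v)"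
      using norm_triangle_ineq4[of y "y - s *\<^sub>R v"] by simp
    moreover have "M + norm x + 1 \<le> norm (s *\<^sub>R v)"
    proof -
      have "M + norm x + 1 \<le> s * norm v"
        using that(2) assms(2) by (simp add: R_def pos_divide_le_eq)
      also have "\<dots> \<le> norm (s *\<^sub>R v)"
        by (simp add: mult_right_mono)
      finally show ?thesis .
    qed
    moreover have "norm y < norm x + 1"
      using that(1) norm_triangle_ineq2[of y x] by (simp add: dist_norm norm_minus_commute)
    ultimately show False by simp
  qed
  have trunc: "integral {0..} (weighted j y) = integral {0..R} (weighted j y)"
    if "y \<in> ball x 1" for j y
    using vanish[OF that] by (intro half_line_truncation) simp
  have "((\<lambda>y. integral {0..} (weighted k y)) has_derivative
      blinfun_apply (integral {0..R} (weighted' k x))) (at x)"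
    using weighted_integral_has_derivative
    by (rule has_derivative_transform_within_open[where s = "ball x 1"]) (simp_all add: trunc)
  moreover have "integral {0..R} (weighted' k x) v + a x * integral {0..} (weighted k x)
      = of_nat k * integral {0..} (weighted (k - 1) x)"
    using weighted_transport[OF assms(1) \<open>R \<ge> 0\<close> vanish[of x R]] by (simp add: trunc)
  ultimately show thesis by (rule that)
qed

end

section \<open>Slices of functions on the sphere bundle\<close>

lemma C1_slice:
  fixes h :: "'a::euclidean_space \<times> 'c::euclidean_space \<Rightarrow> 'b::real_normed_vector"
  assumes "Cn_on 1 U h"
  obtains h' :: "'a \<Rightarrow> 'a \<Rightarrow>\<^sub>L 'b" where
    "\<And>y. (y, \<xi>) \<in> U \<Longrightarrow> ((\<lambda>y. h (y, \<xi>)) has_derivative blinfun_apply (h' y)) (at y)"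
    and "continuous_on {y. (y, \<xi>) \<in> U} h'"
proof -
  define h' where "h' y = Blinfun (\<lambda>w. frechet_derivative h (at (y, \<xi>)) (w, 0))" for y
  have deriv: "(h has_derivative frechet_derivative h (at (y, \<xi>))) (at (y, \<xi>))"
    if "(y, \<xi>) \<in> U" for y
    using assms that by (simp add: frechet_derivative_works)
  have slice: "((\<lambda>y. h (y, \<xi>)) has_derivative (\<lambda>w. frechet_derivative h (at (y, \<xi>)) (w, 0))) (at y)"
    if "(y, \<xi>) \<in> U" for y
  proof -
    have "((\<lambda>y. (y, \<xi>)) has_derivative (\<lambda>w. (w, 0))) (at y)"
      by (auto intro!: derivative_eq_intros)
    from has_derivative_compose[OF this deriv[OF that]] show ?thesis .
  qed
  have h'_apply: "blinfun_apply (h' y) = (\<lambda>w. frechet_derivative h (at (y, \<xi>)) (w, 0))"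
    if "(y, \<xi>) \<in> U" for y
    unfolding h'_def using slice[OF that]
    by (intro bounded_linear_Blinfun_apply has_derivative_bounded_linear)
  have "continuous_on {y. (y, \<xi>) \<in> U} h'"
  proof (rule continuous_on_blinfun_componentwise)
    fix b :: 'a assume "b \<in> Basis"
    then have "continuous_on U (\<lambda>p. frechet_derivative h (at p) (b, 0))"
      using assms by (simp add: Basis_prod_def)
    then have "continuous_on {y. (y, \<xi>) \<in> U} (\<lambda>y. frechet_derivative h (at (y, \<xi>)) (b, 0))"
      by (rule continuous_on_compose2) (auto intro!: continuous_intros)
    then show "continuous_on {y. (y, \<xi>) \<in> U} (\<lambda>y. h' y b)"
      by (rule continuous_on_eq) (simp add: h'_apply)
  qed
  with slice h'_apply show thesis by (intro that) auto
qed

text \<open>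
  The local derivatives \<open>P\<close> agree on overlaps by uniqueness of the derivative, hence glue.
\<close>

lemma local_C1_imp_global:
  fixes q :: "'a::euclidean_space \<Rightarrow> 'b::real_normed_vector"
  assumes local: "\<And>y. \<exists>V P. open V \<and> y \<in> V \<and> continuous_on V P \<and>
     (\<forall>z\<in>V. (q has_derivative blinfun_apply (P z)) (at z))"
  obtains q' where "\<And>y. (q has_derivative blinfun_apply (q' y)) (at y)"
    and "continuous_on UNIV q'"
proof -
  define q' where "q' y = Blinfun (frechet_derivative q (at y))" for y
  have eq: "q' z = P" if "(q has_derivative blinfun_apply P) (at z)" for z P
    by (simp add: q'_def blinfun_apply_inverse flip: frechet_derivative_at[OF that])
  have "(q has_derivative blinfun_apply (q' y)) (at y) \<and> isCont q' y" for y
  proof -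
    obtain V P where VP: "open V" "y \<in> V" "continuous_on V P"
      "\<And>z. z \<in> V \<Longrightarrow> (q has_derivative blinfun_apply (P z)) (at z)"
      using local[of y] by blast
    have "q' z = P z" if "z \<in> V" for z using VP(4)[OF that] by (rule eq)
    then have "continuous_on V q'" using VP(3) by (simp cong: continuous_on_cong)
    with VP eq show ?thesis by (metis continuous_on_eq_continuous_at)
  qed
  then show thesis
    by (intro that) (auto simp: continuous_at_imp_continuous_on)
qed

text \<open>
  The whole space is covered by two open sets: \<open>D\<close>, where the local \<open>C\<^sup>1\<close> extensions of \<open>g\<close> restrict
  to the slice, and the complement of the compact support, where the slice is zero.
\<close>

lemma sphere_bundle_slice_C1:
  fixes g :: "(real^3) \<times> (real^3) \<Rightarrow> 'b::real_normed_vector"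
  assumes "open D" and C1: "C1_on_set (sphere_bundle D) g"
    and "finite_in_x D g" and \<xi>: "\<xi> \<in> sphere 0 1"
  obtains g' where "\<And>y. ((\<lambda>y. g (y, \<xi>)) has_derivative blinfun_apply (g' y)) (at y)"
    and "continuous_on UNIV g'"
proof (rule local_C1_imp_global)
  fix y
  obtain K where K: "compact K" "K \<subseteq> D" "\<And>x. x \<notin> K \<Longrightarrow> g (x, \<xi>) = 0"
    using assms(3) \<xi> by (auto simp: finite_in_x_def)
  show "\<exists>V P. open V \<and> y \<in> V \<and> continuous_on V P \<and>
     (\<forall>z\<in>V. ((\<lambda>y. g (y, \<xi>)) has_derivative blinfun_apply (P z)) (at z))"
  proof (cases "y \<in> D")
    case True
    with C1 \<xi> obtain U h where U: "open U" "(y, \<xi>) \<in> U" and h: "Cn_on 1 U h"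
      and eq: "\<And>q. q \<in> sphere_bundle D \<inter> U \<Longrightarrow> h q = g q"
      unfolding C1_on_set_def by (metis (no_types) SigmaI sphere_bundle_def)
    define V where "V = D \<inter> {z. (z, \<xi>) \<in> U}"
    obtain h' where h': "\<And>z. (z, \<xi>) \<in> U \<Longrightarrow> ((\<lambda>y. h (y, \<xi>)) has_derivative blinfun_apply (h' z)) (at z)"
      and cont: "continuous_on {z. (z, \<xi>) \<in> U} h'"
      using C1_slice[OF h] by blast
    have "open ((\<lambda>z. (z, \<xi>)) -` U)"
      using U(1) by (intro open_vimage continuous_intros)
    then have "open V"
      using \<open>open D\<close> by (auto simp: V_def vimage_def)
    moreover have "continuous_on V h'"
      using cont by (rule continuous_on_subset) (auto simp: V_def)
    moreover have "((\<lambda>y. g (y, \<xi>)) has_derivative blinfun_apply (h' z)) (at z)" if "z \<in> V" for z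
      using that \<xi>
      by (intro has_derivative_transform_within_open[OF h' \<open>open V\<close>])
        (auto simp: V_def sphere_bundle_def intro!: eq)
    ultimately show ?thesis
      using True U(2) by (intro exI[of _ V] exI[of _ h']) (auto simp: V_def)
  next
    case False
    have "open (- K)" using K(1) by (simp add: compact_imp_closed open_Compl)
    moreover have "((\<lambda>y. g (y, \<xi>)) has_derivative blinfun_apply 0) (at z)" if "z \<in> - K" for z
    proof -
      have "((\<lambda>_. 0 :: 'b) has_derivative blinfun_apply 0) (at z)"
        using has_derivative_const[of "0 :: 'b" "at z"] by (simp add: zero_blinfun.rep_eq)
      then show ?thesis
        by (rule has_derivative_transform_within_open[OF _ \<open>open (- K)\<close> that]) (simp add: K(3))
    qed
    ultimately show ?thesis
      using False K(2) by (intro exI[of _ "- K"] exI[of _ "\<lambda>_. 0"]) auto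
  qed
qed (rule that)

section \<open>The attenuated ray transform\<close>

theorem lemma2p1:
  fixes D :: "(real^3) set"
    and \<epsilon> \<rho> :: "(real^3) \<times> (real^3) \<Rightarrow> real"
    and f \<alpha> :: "(real^3) \<times> (real^3) \<Rightarrow> complex"
    and k :: nat and x \<xi> :: "real^3"
  assumes "open D" and "D \<noteq> {}" and "bounded D" and "convex D" and "smooth_boundary D"
    and "C1_on_set (sphere_bundle D) \<epsilon>"
    and "C1_on_set (sphere_bundle D) \<rho>"
    and "C1_on_set (sphere_bundle D) f"
    and "bounded (\<epsilon> ` sphere_bundle D)"
    and "bounded (\<rho> ` sphere_bundle D)"
    and "bounded (f ` sphere_bundle D)"
    and "finite_in_x D \<epsilon>" and "finite_in_x D \<rho>" and "finite_in_x D f"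
    and "\<And>p. p \<in> sphere_bundle D \<Longrightarrow> \<epsilon> p \<ge> 0"
    and "\<alpha> = (\<lambda>p. complex_of_real (\<epsilon> p) + \<i> * complex_of_real (\<rho> p))"
    and "k \<ge> 1"
    and "(x, \<xi>) \<in> sphere_bundle D"
  shows "(\<lambda>y. ART \<alpha> f k (y, \<xi>)) differentiable (at x) \<and>
    H_op (ART \<alpha> f k) (x, \<xi>) + \<alpha> (x, \<xi>) * ART \<alpha> f k (x, \<xi>) = of_nat k * ART \<alpha> f (k - 1) (x, \<xi>)"
proof -
  have \<xi>: "\<xi> \<in> sphere 0 1"
    using assms(18) by (simp add: sphere_bundle_def)
  obtain \<epsilon>' where \<epsilon>': "\<And>y. ((\<lambda>y. \<epsilon> (y, \<xi>)) has_derivative blinfun_apply (\<epsilon>' y)) (at y)"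
    "continuous_on UNIV \<epsilon>'"
    using sphere_bundle_slice_C1[OF assms(1,6,12) \<xi>] by blast
  obtain \<rho>' where \<rho>': "\<And>y. ((\<lambda>y. \<rho> (y, \<xi>)) has_derivative blinfun_apply (\<rho>' y)) (at y)"
    "continuous_on UNIV \<rho>'"
    using sphere_bundle_slice_C1[OF assms(1,7,13) \<xi>] by blast
  obtain f' where f': "\<And>y. ((\<lambda>y. f (y, \<xi>)) has_derivative blinfun_apply (f' y)) (at y)"
    "continuous_on UNIV f'"
    using sphere_bundle_slice_C1[OF assms(1,8,14) \<xi>] by blast
  obtain K where K: "compact K" "\<And>y. y \<notin> K \<Longrightarrow> f (y, \<xi>) = 0"
    using assms(14) \<xi> by (auto simp: finite_in_x_def)
  define \<alpha>' where "\<alpha>' y = (blinfun_scaleR_left 1 o\<^sub>L \<epsilon>' y) + (blinfun_scaleR_left \<i> o\<^sub>L \<rho>' y)" for y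
  interpret attenuated_ray "\<lambda>y. \<alpha> (y, \<xi>)" "\<lambda>y. f (y, \<xi>)" \<alpha>' f' \<xi>
  proof
    show "((\<lambda>y. \<alpha> (y, \<xi>)) has_derivative blinfun_apply (\<alpha>' y)) (at y)" for y
      unfolding assms(16) \<alpha>'_def
      by (rule derivative_eq_intros \<epsilon>'(1) \<rho>'(1) refl)+
        (simp add: fun_eq_iff blinfun.add_left scaleR_conv_of_real)
    show "continuous_on UNIV \<alpha>'"
      unfolding \<alpha>'_def using \<epsilon>'(2) \<rho>'(2) by (intro continuous_intros)
  qed (fact f')+
  have ART: "ART \<alpha> f j (y, \<xi>) = integral {0..} (weighted j y)" for j y
    by (simp add: ART_def weighted_def[abs_def] depth_def)
  obtain L where L: "((\<lambda>y. ART \<alpha> f k (y, \<xi>)) has_derivative L) (at x)"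
    and transport: "L \<xi> + \<alpha> (x, \<xi>) * ART \<alpha> f k (x, \<xi>) = of_nat k * ART \<alpha> f (k - 1) (x, \<xi>)"
    using transport_equation[OF assms(17) _ compact_imp_bounded[OF K(1)] K(2), of x] \<xi>
    unfolding ART by force
  have "((\<lambda>\<tau>. x + \<tau> *\<^sub>R \<xi>) has_derivative (\<lambda>\<tau>. \<tau> *\<^sub>R \<xi>)) (at 0)"
    by (auto intro!: derivative_eq_intros)
  from has_derivative_compose[OF this, of "\<lambda>y. ART \<alpha> f k (y, \<xi>)" L] L
  have "((\<lambda>\<tau>. ART \<alpha> f k (x + \<tau> *\<^sub>R \<xi>, \<xi>)) has_vector_derivative L \<xi>) (at 0)"
    by (simp add: has_vector_derivative_def linear_scale[OF has_derivative_linear[OF L]])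
  then have "H_op (ART \<alpha> f k) (x, \<xi>) = L \<xi>"
    by (simp add: H_op_def vector_derivative_at)
  with L transport show ?thesis
    by (auto simp: differentiable_def)
qed

end
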